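(* Let $m,k\geq 1$ be integers and let $GS_{m}^{k}$ be an orientation of the generalized star (with parameters $m$ and $k$) that has either a single source or a single sink. Then $\chi_{d}(GS_{m}^{k})=m(k-1)+2$.
   Context: The generalized star $GS_{m}^{k}$ is the tree consisting of $m$ paths, each with $k$ edges, all originating from a single common vertex (the central vertex) and otherwise disjoint; it has $mk+1$ vertices. An orientation replaces each edge by exactly one of the two possible arcs. A source is a vertex of in-degree zero and a sink is a vertex of out-degree zero. For a vertex $v$ of a digraph $D$, $N^{+}(v)$ denotes the open out-neighborhood, i.e. the set of vertices $w$ such that $(v,w)$ is an arc; $v$ dominates each vertex of $N^{+}(v)$. A dominator coloring of $D$ is a proper vertex coloring (adjacent vertices of the underlying graph receive different colors) such that every vertex $v$ with $N^{+}(v)\neq\emptyset$ dominates at least one color class, i.e. there is a nonempty color class contained in $N^{+}(v)$ (vertices of out-degree zero are exempt). The dominator chromatic number $\chi_{d}(D)$ is the minimum number of colors in a dominator coloring of $D$.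
   Formalization: Added hypothesis: the single source or sink is an end vertex (degree one) exactly when the central vertex is; otherwise the formula fails, e.g. m=2, k=1 with the path directed from one end to the other needs 3 colors, not 2. *)

theory Defs
  imports "Graph_Theory.Pair_Digraph"
begin

section \<open>Sources, sinks and dominator colorings of digraphs\<close>

definition sources :: "('a, 'b) pre_digraph \<Rightarrow> 'a set" where
  "sources G = {v \<in> verts G. in_degree G v = 0}"

definition sinks :: "('a, 'b) pre_digraph \<Rightarrow> 'a set" where
  "sinks G = {v \<in> verts G. out_degree G v = 0}"

definition out_nbrs :: "('a, 'b) pre_digraph \<Rightarrow> 'a \<Rightarrow> 'a set" where
  "out_nbrs G v = {w. v \<rightarrow>\<^bsub>G\<^esub> w}"

definition proper_coloring :: "('a, 'b) pre_digraph \<Rightarrow> ('a \<Rightarrow> nat) \<Rightarrow> bool" where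
  "proper_coloring G f \<longleftrightarrow> (\<forall>u v. u \<rightarrow>\<^bsub>G\<^esub> v \<longrightarrow> f u \<noteq> f v)"

text \<open>
  Only colors that actually occur on a vertex count, so color classes are nonempty.
\<close>

definition color_class :: "('a, 'b) pre_digraph \<Rightarrow> ('a \<Rightarrow> nat) \<Rightarrow> nat \<Rightarrow> 'a set" where
  "color_class G f c = {v \<in> verts G. f v = c}"

definition dominator_coloring :: "('a, 'b) pre_digraph \<Rightarrow> ('a \<Rightarrow> nat) \<Rightarrow> bool" where
  "dominator_coloring G f \<longleftrightarrow> proper_coloring G f \<and>
     (\<forall>v \<in> verts G. out_nbrs G v \<noteq> {} \<longrightarrow>
        (\<exists>c \<in> f ` verts G. color_class G f c \<subseteq> out_nbrs G v))"

definition dominator_chromatic_number :: "('a, 'b) pre_digraph \<Rightarrow> nat" where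
  "dominator_chromatic_number G =
     (LEAST n. \<exists>f. dominator_coloring G f \<and> card (f ` verts G) = n)"


section \<open>Orientations of generalized stars\<close>

text \<open>
  An undirected simple graph is given by a vertex set \<open>V\<close> and a set \<open>E\<close> of two-element edges.
\<close>

definition orientation_of :: "'a pair_pre_digraph \<Rightarrow> 'a set \<Rightarrow> 'a set set \<Rightarrow> bool" where
  "orientation_of D V E \<longleftrightarrow> pverts D = V \<and>
     (\<forall>(u, v) \<in> parcs D. {u, v} \<in> E) \<and>
     (\<forall>u v. {u, v} \<in> E \<longrightarrow> ((u, v) \<in> parcs D) \<noteq> ((v, u) \<in> parcs D))"

definition end_vertex :: "'a set set \<Rightarrow> 'a \<Rightarrow> bool" where
  "end_vertex E v \<longleftrightarrow> card {e \<in> E. v \<in> e} = 1"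

text \<open>
  The vertex \<open>(i, j)\<close> is the one at distance \<open>j\<close> from the center on the \<open>i\<close>-th path,
  for \<open>1 \<le> i \<le> m\<close> and \<open>1 \<le> j \<le> k\<close>; the center common to all paths is \<open>(0, 0)\<close>.
\<close>

definition gs_center :: "nat \<times> nat" where
  "gs_center = (0, 0)"

definition gs_verts :: "nat \<Rightarrow> nat \<Rightarrow> (nat \<times> nat) set" where
  "gs_verts m k = insert gs_center ({1..m} \<times> {1..k})"

text \<open>The second part is empty when \<open>k = 1\<close>.\<close>

definition gs_edges :: "nat \<Rightarrow> nat \<Rightarrow> (nat \<times> nat) set set" where
  "gs_edges m k =
     {{gs_center, (i, 1)} | i. i \<in> {1..m}} \<union>
     {{(i, j), (i, j + 1)} | i j. i \<in> {1..m} \<and> j \<in> {1..<k}}"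

text \<open>
  On the role of \<^const>\<open>end_vertex\<close>: an orientation with a unique source (or a unique sink)
  \<open>r\<close> is an out-tree (or in-tree) rooted at \<open>r\<close>, and its dominator chromatic number depends
  on the number of end vertices other than \<open>r\<close>. That number is the same as for the root at
  the center exactly if \<open>r\<close> is an end vertex just in case the center is one (which
  happens only for \<open>m = 1\<close>). Without this restriction on \<open>r\<close> the value \<open>m(k-1)+2\<close>
  is not correct: the directed path on three vertices (\<open>m = 2\<close>, \<open>k = 1\<close>, rooted at
  an end vertex) needs 3 colors instead of 2, and the path on three vertices directed away
  from its middle vertex (\<open>m = 1\<close>, \<open>k = 2\<close>) needs 2 colors instead of 3.
  The restriction always holds if \<open>r\<close> is the center.
\<close>

end

theory Submission
  imports Defs
begin

text \<open>
  Since a tree has one edge fewer than it has vertices, counting arcs by their heads shows that an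
  orientation with a single source \<open>r\<close> gives in-degree one to every other vertex: it is an
  out-tree with root \<open>r\<close> (\<open>single_source_structure\<close>). Reversing all arcs, an orientation with
  a single sink is an in-tree. In both cases the \<open>leaves\<close>, i.e. the sinks of the out-tree or
  the sources of the in-tree, are the vertices other than \<open>r\<close> that lie on only one edge.

  In an out-tree the out-neighborhoods are pairwise disjoint and avoid \<open>r\<close>. Each of the
  \<open>p\<close> non-leaves needs a color class within its own out-neighborhood, and the class of
  \<open>r\<close> is yet another one, so \<open>p + 1\<close> colors are necessary. They suffice: color each
  vertex by its parent and give \<open>r\<close> a color of its own (\<open>dominator_chromatic_number_out_tree\<close>).

  In an in-tree every out-neighborhood of a non-root is a single vertex, so every non-leaf must be
  a color class by itself, and the leaves need at least one further color. One is enough, because no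
  arc joins two leaves (\<open>dominator_chromatic_number_in_tree\<close>).

  So the number is always one more than the number of non-leaves. The star has \<open>m k + 1\<close>
  vertices. It has \<open>m\<close> leaves: if \<open>m \<ge> 2\<close>, its \<open>m\<close> end vertices are the tips of
  the paths, and \<open>r\<close> is not one of them; if \<open>m = 1\<close>, it is a path and \<open>r\<close> is one of
  its two ends. This gives \<open>m k + 1 - m + 1 = m (k - 1) + 2\<close>.
\<close>

section \<open>Digraphs given by pairs\<close>

lemma sources_with_proj:
  assumes "finite (parcs D)"
  shows "sources (with_proj D) = pverts D - Range (parcs D)"
proof -
  have "in_degree (with_proj D) v = 0 \<longleftrightarrow> v \<notin> Range (parcs D)" for v
  proof -
    have "finite (in_arcs (with_proj D) v)"
      using assms by (simp add: in_arcs_def)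
    then show ?thesis
      by (auto simp: in_degree_def in_arcs_def)
  qed
  then show ?thesis
    by (auto simp: sources_def)
qed

lemma sinks_with_proj:
  assumes "finite (parcs D)"
  shows "sinks (with_proj D) = pverts D - Domain (parcs D)"
proof -
  have "out_degree (with_proj D) v = 0 \<longleftrightarrow> v \<notin> Domain (parcs D)" for v
  proof -
    have "finite (out_arcs (with_proj D) v)"
      using assms by (simp add: out_arcs_def)
    then show ?thesis
      by (auto simp: out_degree_def out_arcs_def)
  qed
  then show ?thesis
    by (auto simp: sinks_def)
qed

lemma arc_with_proj_iff: "u \<rightarrow>\<^bsub>with_proj D\<^esub> v \<longleftrightarrow> (u, v) \<in> parcs D"
  by (simp add: arcs_ends_def arc_to_ends_def)

lemma dominator_coloring_with_proj_iff:
  "dominator_coloring (with_proj D) f \<longleftrightarrow>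
     (\<forall>(u, v) \<in> parcs D. f u \<noteq> f v) \<and>
     (\<forall>u \<in> pverts D \<inter> Domain (parcs D). \<exists>c \<in> f ` pverts D.
        \<forall>w \<in> pverts D. f w = c \<longrightarrow> (u, w) \<in> parcs D)"
  unfolding dominator_coloring_def proper_coloring_def out_nbrs_def color_class_def
    arc_with_proj_iff
  by (simp add: Domain_iff subset_iff) blast

lemma dominator_chromatic_number_eqI:
  assumes "dominator_coloring G f" and "card (f ` verts G) = n"
    and "\<And>g. dominator_coloring G g \<Longrightarrow> n \<le> card (g ` verts G)"
  shows "dominator_chromatic_number G = n"
  unfolding dominator_chromatic_number_def
  by (rule Least_equality) (use assms in auto)

section \<open>Dominator colorings of out-trees and in-trees\<close>

text \<open>
  For the upper bound each vertex is colored by its parent, so that the color classes are \<open>{r}\<close>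
  and the out-neighborhoods of the non-leaves. For the lower bound, two vertices cannot dominate
  the same class, as a vertex in it would have two parents, and the class of \<open>r\<close> is not
  dominated at all, as \<open>r\<close> has no parent.
\<close>

lemma dominator_chromatic_number_out_tree:
  assumes fin: "finite (pverts D)" and r: "r \<in> pverts D"
    and dom: "Domain (parcs D) \<subseteq> pverts D" and ran: "Range (parcs D) = pverts D - {r}"
    and inj: "inj_on snd (parcs D)" and irr: "\<And>v. (v, v) \<notin> parcs D"
  shows "dominator_chromatic_number (with_proj D) = Suc (card (Domain (parcs D)))"
proof -
  have finD: "finite (Domain (parcs D))"
    using fin dom by (rule rev_finite_subset)
  have uniq: "u = u'" if "(u, v) \<in> parcs D" "(u', v) \<in> parcs D" for u u' v
    using inj_onD[OF inj _ that] by simp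
  obtain h :: "'a \<Rightarrow> nat" where h: "inj_on h (pverts D)"
    using finite_imp_inj_to_nat_seg[OF fin] by blast
  define par where "par v = (THE u. (u, v) \<in> parcs D)" for v
  have par: "par v = u" if "(u, v) \<in> parcs D" for u v
    unfolding par_def using that uniq by blast
  have par_arc: "(par v, v) \<in> parcs D" if "v \<in> pverts D" "v \<noteq> r" for v
  proof -
    have "v \<in> Range (parcs D)" using that ran by simp
    then show ?thesis using par by auto
  qed
  define f where "f v = (if v = r then 0 else Suc (h (par v)))" for v
  have f_arc: "f v = Suc (h u)" if "(u, v) \<in> parcs D" for u v
  proof -
    have "v \<noteq> r" using that ran by blast
    then show ?thesis using par[OF that] by (simp add: f_def)
  qed
  have f_class: "(u, w) \<in> parcs D"
    if "u \<in> pverts D" "w \<in> pverts D" "f w = Suc (h u)" for u w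
  proof -
    have w: "w \<noteq> r" "h (par w) = h u" using that(3) by (auto simp: f_def split: if_splits)
    have arc: "(par w, w) \<in> parcs D" using par_arc that w by blast
    then have "par w \<in> pverts D" using dom by blast
    then have "par w = u" using h that(1) w(2) by (meson inj_onD)
    then show ?thesis using arc by simp
  qed
  have coloring: "dominator_coloring (with_proj D) f"
    unfolding dominator_coloring_with_proj_iff
  proof (intro conjI ballI, clarify)
    fix u v assume arc: "(u, v) \<in> parcs D" and eq: "f u = f v"
    then have "u \<in> pverts D" using dom by blast
    then have "(u, u) \<in> parcs D" using f_class[of u u] f_arc[OF arc] eq by simp
    then show False using irr by blast
  next
    fix u assume u: "u \<in> pverts D \<inter> Domain (parcs D)"
    then obtain v where uv: "(u, v) \<in> parcs D" by blast
    then have "v \<in> pverts D" using ran by blast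
    then have "Suc (h u) \<in> f ` pverts D" using f_arc[OF uv] by (metis imageI)
    then show "\<exists>c\<in>f ` pverts D. \<forall>w\<in>pverts D. f w = c \<longrightarrow> (u, w) \<in> parcs D"
      using f_class u by blast
  qed
  have "f ` pverts D = insert 0 (Suc ` h ` Domain (parcs D))"
  proof
    show "f ` pverts D \<subseteq> insert 0 (Suc ` h ` Domain (parcs D))"
    proof
      fix c assume "c \<in> f ` pverts D"
      then obtain v where v: "v \<in> pverts D" "c = f v" by blast
      show "c \<in> insert 0 (Suc ` h ` Domain (parcs D))"
      proof (cases "v = r")
        case False
        then show ?thesis using par_arc[OF v(1)] v(2) by (auto simp: f_def)
      qed (simp add: v f_def)
    qed
    have "Suc (h u) \<in> f ` pverts D" if "(u, v) \<in> parcs D" for u v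
      using f_arc[OF that] ran that by (metis DiffD1 Range.intros imageI)
    moreover have "0 \<in> f ` pverts D"
      using r by (force simp: f_def)
    ultimately show "insert 0 (Suc ` h ` Domain (parcs D)) \<subseteq> f ` pverts D" by auto
  qed
  moreover have "card (Suc ` h ` Domain (parcs D)) = card (Domain (parcs D))"
    using h dom by (simp add: card_image inj_on_subset)
  ultimately have card: "card (f ` verts (with_proj D)) = Suc (card (Domain (parcs D)))"
    using finD by simp
  have lower: "Suc (card (Domain (parcs D))) \<le> card (g ` verts (with_proj D))"
    if g: "dominator_coloring (with_proj D) g" for g
  proof -
    have "\<forall>u \<in> Domain (parcs D). \<exists>c. c \<in> g ` pverts D \<and>
        (\<forall>w \<in> pverts D. g w = c \<longrightarrow> (u, w) \<in> parcs D)"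
      using g dom unfolding dominator_coloring_with_proj_iff by blast
    from bchoice[OF this] obtain c where c: "\<forall>u \<in> Domain (parcs D). c u \<in> g ` pverts D \<and>
        (\<forall>w \<in> pverts D. g w = c u \<longrightarrow> (u, w) \<in> parcs D)"
      by blast
    then have c1: "c u \<in> g ` pverts D" if "u \<in> Domain (parcs D)" for u
      using that by blast
    have c2: "(u, w) \<in> parcs D"
      if "u \<in> Domain (parcs D)" "w \<in> pverts D" "g w = c u" for u w
      using c that by blast
    \<comment> \<open>A common color would have a vertex with two in-neighbors.\<close>
    have "inj_on c (Domain (parcs D))"
    proof (rule inj_onI)
      fix u u' assume u: "u \<in> Domain (parcs D)" "u' \<in> Domain (parcs D)" "c u = c u'"
      obtain w where "w \<in> pverts D" "g w = c u" using c1[OF u(1)] by force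
      then show "u = u'" using c2[of _ w] u uniq by metis
    qed
    then have "Suc (card (Domain (parcs D))) = card (insert (g r) (c ` Domain (parcs D)))"
    proof -
      have "g r \<notin> c ` Domain (parcs D)"
        using c2[OF _ r] ran by blast
      then show ?thesis
        using finD \<open>inj_on c _\<close> by (simp add: card_image)
    qed
    also have "\<dots> \<le> card (g ` pverts D)"
      using fin r c1 by (intro card_mono) auto
    finally show ?thesis by simp
  qed
  show ?thesis
    using coloring card lower by (rule dominator_chromatic_number_eqI)
qed

text \<open>
  Out-degrees are at most one, so a vertex that dominates a class dominates a singleton: each head
  of an arc is alone in its class. The leaf \<open>s\<close> accounts for the additional color.
\<close>

lemma dominator_chromatic_number_in_tree:
  assumes fin: "finite (pverts D)" and s: "s \<in> pverts D" "s \<notin> Range (parcs D)"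
    and dom: "Domain (parcs D) \<subseteq> pverts D" and ran: "Range (parcs D) \<subseteq> pverts D"
    and inj: "inj_on fst (parcs D)" and irr: "\<And>v. (v, v) \<notin> parcs D"
  shows "dominator_chromatic_number (with_proj D) = Suc (card (Range (parcs D)))"
proof -
  have finR: "finite (Range (parcs D))"
    using fin ran by (rule rev_finite_subset)
  have uniq: "v = v'" if "(u, v) \<in> parcs D" "(u, v') \<in> parcs D" for u v v'
    using inj_onD[OF inj _ that] by simp
  obtain h :: "'a \<Rightarrow> nat" where h: "inj_on h (pverts D)"
    using finite_imp_inj_to_nat_seg[OF fin] by blast
  define f where "f v = (if v \<in> Range (parcs D) then Suc (h v) else 0)" for v
  have f_class: "w = v" if "v \<in> Range (parcs D)" "w \<in> pverts D" "f w = f v" for v w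
  proof -
    have "h w = h v" using that by (auto simp: f_def split: if_splits)
    then show ?thesis using h that ran by (meson inj_onD subsetD)
  qed
  have coloring: "dominator_coloring (with_proj D) f"
    unfolding dominator_coloring_with_proj_iff
  proof (intro conjI ballI, clarify)
    fix u v assume "(u, v) \<in> parcs D" "f u = f v"
    then have "u = v" using f_class dom by blast
    then show False using \<open>(u, v) \<in> parcs D\<close> irr by blast
  next
    fix u assume "u \<in> pverts D \<inter> Domain (parcs D)"
    then obtain v where uv: "(u, v) \<in> parcs D" by blast
    then have v: "v \<in> Range (parcs D)" by blast
    show "\<exists>c\<in>f ` pverts D. \<forall>w\<in>pverts D. f w = c \<longrightarrow> (u, w) \<in> parcs D"
    proof (intro bexI ballI impI)
      show "f v \<in> f ` pverts D" using v ran by blast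
      show "(u, w) \<in> parcs D" if "w \<in> pverts D" "f w = f v" for w
        using f_class[OF v that] uv by simp
    qed
  qed
  have "f ` pverts D = insert 0 (Suc ` h ` Range (parcs D))"
    using s ran by (force simp: f_def image_iff)
  moreover have "card (Suc ` h ` Range (parcs D)) = card (Range (parcs D))"
    using h ran by (simp add: card_image inj_on_subset)
  ultimately have card: "card (f ` verts (with_proj D)) = Suc (card (Range (parcs D)))"
    using finR by simp
  have lower: "Suc (card (Range (parcs D))) \<le> card (g ` verts (with_proj D))"
    if g: "dominator_coloring (with_proj D) g" for g
  proof -
    \<comment> \<open>An in-neighbor of \<open>v\<close> can only dominate the class \<open>{v}\<close>.\<close>
    have single: "w = v" if v: "v \<in> Range (parcs D)" and w: "w \<in> pverts D" "g w = g v" for v w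
    proof -
      obtain u where u: "(u, v) \<in> parcs D" using v by blast
      then have "u \<in> pverts D \<inter> Domain (parcs D)" using dom by blast
      then obtain x where x: "x \<in> pverts D"
          "\<And>y. y \<in> pverts D \<Longrightarrow> g y = g x \<Longrightarrow> (u, y) \<in> parcs D"
        using g unfolding dominator_coloring_with_proj_iff by blast
      have "x = v" using x u uniq by blast
      then show ?thesis using x(2) w u uniq by blast
    qed
    have "inj_on g (Range (parcs D))"
      using single ran by (blast intro: inj_onI)
    moreover have "g s \<notin> g ` Range (parcs D)"
      using single s by blast
    ultimately have "Suc (card (Range (parcs D))) = card (insert (g s) (g ` Range (parcs D)))"
      using finR by (simp add: card_image)
    also have "\<dots> \<le> card (g ` pverts D)"
      using fin s ran by (intro card_mono) auto
    finally show ?thesis by simp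
  qed
  show ?thesis
    using coloring card lower by (rule dominator_chromatic_number_eqI)
qed

section \<open>Orientations with a single source or sink\<close>

definition reverse :: "'a pair_pre_digraph \<Rightarrow> 'a pair_pre_digraph" where
  "reverse D = \<lparr>pverts = pverts D, parcs = (parcs D)\<inverse>\<rparr>"

lemma pverts_reverse [simp]: "pverts (reverse D) = pverts D"
  and parcs_reverse [simp]: "parcs (reverse D) = (parcs D)\<inverse>"
  by (simp_all add: reverse_def)

lemma card_2_other_element:
  assumes "card e = 2" "v \<in> e"
  shows "\<exists>w. e = {v, w}"
proof -
  obtain a b where ab: "e = {a, b}"
    using assms(1) by (meson card_2_iff)
  then show ?thesis
    using assms(2) insert_commute[of a b "{}"] by blast
qed

lemma orientation_of_arc_edge:
  assumes "orientation_of D V E" "(u, v) \<in> parcs D"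
  shows "{u, v} \<in> E"
  using assms unfolding orientation_of_def by blast

lemma orientation_of_edge_arc:
  assumes "orientation_of D V E" "{u, v} \<in> E"
  shows "(u, v) \<in> parcs D \<longleftrightarrow> (v, u) \<notin> parcs D"
proof -
  have "((u, v) \<in> parcs D) \<noteq> ((v, u) \<in> parcs D)"
    using assms by (simp add: orientation_of_def)
  then show ?thesis by blast
qed

lemma orientation_of_reverse:
  assumes "orientation_of D V E"
  shows "orientation_of (reverse D) V E"
  unfolding orientation_of_def
proof (intro conjI allI impI)
  show "pverts (reverse D) = V"
    using assms by (simp add: orientation_of_def)
  show "\<forall>(u, v) \<in> parcs (reverse D). {u, v} \<in> E"
  proof clarsimp
    fix u v assume "(v, u) \<in> parcs D"
    then show "{u, v} \<in> E"
      using orientation_of_arc_edge[OF assms] by (subst insert_commute)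
  qed
  show "((u, v) \<in> parcs (reverse D)) \<noteq> ((v, u) \<in> parcs (reverse D))" if "{u, v} \<in> E" for u v
    using orientation_of_edge_arc[OF assms that] by auto
qed

lemma orientation_of_no_opposite_arcs:
  assumes "orientation_of D V E" "(u, v) \<in> parcs D"
  shows "(v, u) \<notin> parcs D"
  using orientation_of_edge_arc[OF assms(1) orientation_of_arc_edge[OF assms]] assms(2) by simp

lemma orientation_of_arc_in_verts:
  assumes "orientation_of D V E" "\<Union>E = V" "(u, v) \<in> parcs D"
  shows "u \<in> V" "v \<in> V"
  using orientation_of_arc_edge[OF assms(1,3)] unfolding assms(2)[symmetric] by (auto intro: UnionI)

lemma finite_parcs_orientation:
  assumes "orientation_of D V E" "\<Union>E = V" "finite V"
  shows "finite (parcs D)"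
proof (rule finite_subset)
  show "parcs D \<subseteq> V \<times> V" using orientation_of_arc_in_verts[OF assms(1,2)] by auto
qed (use assms in simp)

lemma card_parcs_orientation_le:
  assumes or: "orientation_of D V E" and E: "finite E"
  shows "card (parcs D) \<le> card E"
proof (rule card_inj_on_le)
  show "inj_on (\<lambda>(u, v). {u, v}) (parcs D)"
    using orientation_of_no_opposite_arcs[OF or] by (auto simp: inj_on_def doubleton_eq_iff)
  show "(\<lambda>(u, v). {u, v}) ` parcs D \<subseteq> E"
    using orientation_of_arc_edge[OF or] by auto
qed (rule E)

lemma card_incident_edges_orientation:
  assumes or: "orientation_of D V E" and E: "\<forall>e \<in> E. card e = 2"
    and fin: "finite (parcs D)"
  shows "card {e \<in> E. v \<in> e} = card (parcs D `` {v}) + card ((parcs D)\<inverse> `` {v})"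
proof -
  let ?N = "parcs D `` {v} \<union> (parcs D)\<inverse> `` {v}"
  have "{e \<in> E. v \<in> e} = (\<lambda>w. {v, w}) ` ?N"
  proof (intro equalityI subsetI)
    fix e assume e: "e \<in> {e \<in> E. v \<in> e}"
    then have eE: "e \<in> E" and ve: "v \<in> e" by simp_all
    obtain w where w: "e = {v, w}"
      using card_2_other_element[OF bspec[OF E eE] ve] ..
    then have "w \<in> ?N"
      using orientation_of_edge_arc[OF or, of v w] eE by auto
    then show "e \<in> (\<lambda>w. {v, w}) ` ?N" using w by blast
  next
    fix e assume "e \<in> (\<lambda>w. {v, w}) ` ?N"
    then obtain w where w: "e = {v, w}" "(v, w) \<in> parcs D \<or> (w, v) \<in> parcs D"
      by blast
    then have "{v, w} \<in> E \<or> {w, v} \<in> E"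
      using orientation_of_arc_edge[OF or] by blast
    then show "e \<in> {e \<in> E. v \<in> e}"
      using w(1) by (simp add: insert_commute)
  qed
  moreover have "inj_on (\<lambda>w. {v, w}) ?N"
    by (auto simp: inj_on_def doubleton_eq_iff)
  ultimately have "card {e \<in> E. v \<in> e} = card ?N"
    by (simp add: card_image)
  also have "\<dots> = card (parcs D `` {v}) + card ((parcs D)\<inverse> `` {v})"
    using orientation_of_no_opposite_arcs[OF or] fin
    by (intro card_Un_disjoint) (auto intro: finite_Image)
  finally show ?thesis .
qed

text \<open>
  The hypothesis that there are fewer edges than vertices is where being a tree enters. As every
  vertex other than \<open>r\<close> is the head of some arc, there are just enough arcs for each of them to
  be the head of one. Such a vertex has out-degree zero iff this one arc is its only edge.
\<close>

lemma single_source_structure: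
  assumes or: "orientation_of D V E" and src: "sources (with_proj D) = {r}"
    and V: "finite V" "\<Union>E = V" and E: "\<forall>e \<in> E. card e = 2"
    and few: "card E < card V"
  shows "Range (parcs D) = V - {r}" and "inj_on snd (parcs D)"
    and "V - Domain (parcs D) = {v \<in> V. end_vertex E v} - {r}"
proof -
  have finE: "finite E" using V by (metis finite_UnionD)
  have finA: "finite (parcs D)" using finite_parcs_orientation[OF or V(2,1)] .
  have pV: "pverts D = V" using or by (simp add: orientation_of_def)
  have src': "V - Range (parcs D) = {r}"
    using src sources_with_proj[OF finA] pV by simp
  moreover have "Range (parcs D) \<subseteq> V"
    using orientation_of_arc_in_verts[OF or V(2)] by auto
  ultimately show ran: "Range (parcs D) = V - {r}" by blast
  have rV: "r \<in> V" using src' by blast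
  have img: "snd ` parcs D = V - {r}"
    using ran by (simp add: Range_snd)
  have "card (parcs D) \<le> card (V - {r})"
    using card_parcs_orientation_le[OF or finE] few rV V(1) by simp
  also have "\<dots> = card (snd ` parcs D)" using img by simp
  finally show inj: "inj_on snd (parcs D)"
    using finA by (simp add: card_image_le eq_card_imp_inj_on le_antisym)
  have r_arc: "r \<in> Domain (parcs D)"
  proof -
    obtain e where e: "e \<in> E" "r \<in> e" using rV V(2) by blast
    obtain w where w: "e = {r, w}"
      using card_2_other_element[OF bspec[OF E e(1)] e(2)] ..
    have "(r, w) \<in> parcs D \<or> (w, r) \<in> parcs D"
      using orientation_of_edge_arc[OF or, of r w] e w by blast
    then show ?thesis using ran by blast
  qed
  have "v \<notin> Domain (parcs D) \<longleftrightarrow> end_vertex E v" if v: "v \<in> V" "v \<noteq> r" for v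
  proof -
    obtain u where u: "(u, v) \<in> parcs D" using v ran by blast
    have "w = u" if "(w, v) \<in> parcs D" for w
      using inj_onD[OF inj _ that u] by simp
    with u have "(parcs D)\<inverse> `` {v} = {u}" by blast
    moreover have "finite (parcs D `` {v})" using finA by (auto intro: finite_Image)
    ultimately show ?thesis
      unfolding end_vertex_def card_incident_edges_orientation[OF or E finA]
      by (auto simp: Domain_iff)
  qed
  then show "V - Domain (parcs D) = {v \<in> V. end_vertex E v} - {r}"
    using r_arc by blast
qed

text \<open>
  Reversal turns a single sink into a single source and preserves the end vertices. So the non-leaves,
  which are the tails of arcs in an out-tree and the heads of arcs in an in-tree, are equally many
  in both cases, and the two chromatic numbers agree although the colorings differ.
\<close>

theorem dominator_chromatic_number_single_source_or_sink:
  assumes or: "orientation_of D V E"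
    and root: "sources (with_proj D) = {r} \<or> sinks (with_proj D) = {r}"
    and V: "finite V" "\<Union>E = V" and E: "\<forall>e \<in> E. card e = 2"
    and few: "card E < card V"
  shows "dominator_chromatic_number (with_proj D) + card ({v \<in> V. end_vertex E v} - {r})
    = card V + 1"
proof -
  let ?L = "{v \<in> V. end_vertex E v} - {r}"
  have pV: "pverts D = V" using or by (simp add: orientation_of_def)
  have finA: "finite (parcs D)" using finite_parcs_orientation[OF or V(2,1)] .
  have irr: "(v, v) \<notin> parcs D" for v
    using orientation_of_no_opposite_arcs[OF or] by blast
  have dom: "Domain (parcs D) \<subseteq> V" and ran: "Range (parcs D) \<subseteq> V"
    using orientation_of_arc_in_verts[OF or V(2)] by auto
  have complement: "card X + card ?L = card V" if "X \<subseteq> V" "V - X = ?L" for X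
  proof -
    have "card (V - X) = card V - card X" "card X \<le> card V"
      using that(1) V(1) by (simp_all add: card_Diff_subset finite_subset card_mono)
    then show ?thesis unfolding that(2) by simp
  qed
  from root show ?thesis
  proof
    assume src: "sources (with_proj D) = {r}"
    note tree = single_source_structure[OF or src V E few]
    have "r \<in> V" using src pV by (auto simp: sources_def)
    then have "dominator_chromatic_number (with_proj D) = Suc (card (Domain (parcs D)))"
      using tree(1,2) dom pV V(1) irr by (intro dominator_chromatic_number_out_tree) auto
    then show ?thesis using complement[OF dom tree(3)] by simp
  next
    assume snk: "sinks (with_proj D) = {r}"
    then have src: "sources (with_proj (reverse D)) = {r}"
      using finA by (simp add: sources_with_proj sinks_with_proj)
    note tree = single_source_structure[OF orientation_of_reverse[OF or] src V E few]
    have inj: "inj_on fst (parcs D)"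
    proof (rule inj_onI)
      fix a b assume ab: "a \<in> parcs D" "b \<in> parcs D" "fst a = fst b"
      have "(snd a, fst a) \<in> parcs (reverse D)" "(snd b, fst b) \<in> parcs (reverse D)"
        using ab(1,2) by simp_all
      from inj_onD[OF tree(2) _ this] ab(3) show "a = b"
        by (simp add: prod_eq_iff)
    qed
    \<comment> \<open>The color shared by the leaves only counts if there is a leaf. There is one because
      there are fewer arcs than vertices, so that not every vertex can be the head of an arc.\<close>
    have "card (Range (parcs D)) \<le> card (parcs D)"
      using finA by (simp add: Range_snd card_image_le)
    also have "\<dots> < card V"
      using card_parcs_orientation_le[OF or] finite_UnionD[of E] few V by simp
    finally have "Range (parcs D) \<noteq> V" by blast
    then obtain s where s: "s \<in> V" "s \<notin> Range (parcs D)"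
      using ran by blast
    have "dominator_chromatic_number (with_proj D) = Suc (card (Range (parcs D)))"
      using s dom ran pV V(1) irr inj by (intro dominator_chromatic_number_in_tree) auto
    moreover have "V - Range (parcs D) = ?L" using tree(3) by simp
    ultimately show ?thesis using complement[OF ran] by simp
  qed
qed

section \<open>Generalized stars\<close>

definition gs_parent :: "nat \<times> nat \<Rightarrow> nat \<times> nat" where
  "gs_parent v = (if snd v = 1 then gs_center else (fst v, snd v - 1))"

text \<open>
  Naming each edge by its end that is farther from the center makes edges easy to count.
\<close>

lemma gs_edges_eq: "gs_edges m k = (\<lambda>v. {v, gs_parent v}) ` ({1..m} \<times> {1..k})"
  if "k \<ge> 1"
proof (intro equalityI subsetI)
  fix e assume "e \<in> gs_edges m k"
  then consider i where "i \<in> {1..m}" "e = {gs_center, (i, 1)}"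
    | i j where "i \<in> {1..m}" "j \<in> {1..<k}" "e = {(i, j), (i, j + 1)}"
    unfolding gs_edges_def by blast
  then show "e \<in> (\<lambda>v. {v, gs_parent v}) ` ({1..m} \<times> {1..k})"
  proof cases
    case 1
    then show ?thesis using that
      by (intro image_eqI[where x = "(i, 1)"]) (auto simp: gs_parent_def)
  next
    case 2
    then show ?thesis
      by (intro image_eqI[where x = "(i, j + 1)"]) (auto simp: gs_parent_def)
  qed
next
  fix e assume "e \<in> (\<lambda>v. {v, gs_parent v}) ` ({1..m} \<times> {1..k})"
  then obtain i j where ij: "i \<in> {1..m}" "j \<in> {1..k}" "e = {(i, j), gs_parent (i, j)}"
    by auto
  show "e \<in> gs_edges m k"
  proof (cases "j = 1")
    case True
    then show ?thesis using ij by (auto simp: gs_edges_def gs_parent_def)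
  next
    case False
    then have "e = {(i, j - 1), (i, (j - 1) + 1)}" "j - 1 \<in> {1..<k}"
      using ij by (auto simp: gs_parent_def)
    then show ?thesis using ij(1) unfolding gs_edges_def by blast
  qed
qed

lemma inj_on_gs_edge: "inj_on (\<lambda>v. {v, gs_parent v}) ({1..m} \<times> {1..k})"
  by (rule inj_onI)
    (auto simp: doubleton_eq_iff gs_parent_def gs_center_def split: if_splits)

lemma finite_gs_verts: "finite (gs_verts m k)"
  by (simp add: gs_verts_def)

lemma card_gs_verts: "card (gs_verts m k) = m * k + 1"
  by (simp add: gs_verts_def gs_center_def)

lemma card_gs_edges: "k \<ge> 1 \<Longrightarrow> card (gs_edges m k) = m * k"
  using card_image[OF inj_on_gs_edge, of m k] by (simp add: gs_edges_eq)

lemma card_gs_edge: "k \<ge> 1 \<Longrightarrow> \<forall>e \<in> gs_edges m k. card e = 2"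
  unfolding gs_edges_eq by (auto simp: gs_parent_def gs_center_def card_insert_if)

lemma Union_gs_edges:
  assumes "m \<ge> 1" "k \<ge> 1"
  shows "\<Union>(gs_edges m k) = gs_verts m k"
proof
  show "\<Union>(gs_edges m k) \<subseteq> gs_verts m k"
    unfolding gs_edges_eq[OF assms(2)] by (auto simp: gs_verts_def gs_parent_def split: if_splits)
  have "gs_center \<in> {(1, 1), gs_parent (1, 1)}" "(1, 1) \<in> {1..m} \<times> {1..k}"
    using assms by (auto simp: gs_parent_def)
  then show "gs_verts m k \<subseteq> \<Union>(gs_edges m k)"
    unfolding gs_edges_eq[OF assms(2)] gs_verts_def by blast
qed

lemma card_gs_edges_at:
  assumes "k \<ge> 1"
  shows "card {e \<in> gs_edges m k. v \<in> e} =
    card {w \<in> {1..m} \<times> {1..k}. v = w \<or> v = gs_parent w}"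
proof -
  have "{e \<in> gs_edges m k. v \<in> e} =
    (\<lambda>w. {w, gs_parent w}) ` {w \<in> {1..m} \<times> {1..k}. v = w \<or> v = gs_parent w}"
    unfolding gs_edges_eq[OF assms] by auto
  then show ?thesis
    using inj_on_subset[OF inj_on_gs_edge, of _ m k]
    by (metis (no_types, lifting) card_image mem_Collect_eq subsetI)
qed

lemma end_vertex_gs_center:
  assumes "k \<ge> 1"
  shows "end_vertex (gs_edges m k) gs_center \<longleftrightarrow> m = 1"
proof -
  have "{w \<in> {1..m} \<times> {1..k}. gs_center = w \<or> gs_center = gs_parent w} = {1..m} \<times> {1}"
    using assms by (auto simp: gs_center_def gs_parent_def split: if_splits)
  then show ?thesis
    unfolding end_vertex_def card_gs_edges_at[OF assms] by simp
qed

lemma end_vertex_gs_path: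
  assumes "i \<in> {1..m}" "j \<in> {1..k}"
  shows "end_vertex (gs_edges m k) (i, j) \<longleftrightarrow> j = k"
proof -
  have "{w \<in> {1..m} \<times> {1..k}. (i, j) = w \<or> (i, j) = gs_parent w} =
    (if j = k then {(i, j)} else {(i, j), (i, j + 1)})"
    using assms by (auto simp: gs_center_def gs_parent_def split: if_splits)
  moreover have "k \<ge> 1" using assms by simp
  ultimately show ?thesis
    unfolding end_vertex_def card_gs_edges_at[OF \<open>k \<ge> 1\<close>] by simp
qed

lemma card_gs_end_vertices_except_root:
  assumes "m \<ge> 1" "k \<ge> 1" "r \<in> gs_verts m k"
    and r: "end_vertex (gs_edges m k) r \<longleftrightarrow> end_vertex (gs_edges m k) gs_center"
  shows "card ({v \<in> gs_verts m k. end_vertex (gs_edges m k) v} - {r}) = m"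
proof -
  let ?ends = "{v \<in> gs_verts m k. end_vertex (gs_edges m k) v}"
  have ends: "?ends = (if m = 1 then {gs_center} else {}) \<union> {1..m} \<times> {k}"
    using end_vertex_gs_center[OF assms(2)] end_vertex_gs_path[of _ m _ k] assms(2)
    by (auto simp: gs_verts_def)
  show ?thesis
  proof (cases "m = 1")
    case True
    then have "?ends = {gs_center, (1, k)}" "gs_center \<noteq> (1, k)"
      using ends by (auto simp: gs_center_def)
    moreover have "r \<in> ?ends"
      using assms True end_vertex_gs_center by simp
    ultimately show ?thesis using True by simp
  next
    case False
    then have "r \<notin> ?ends" using r end_vertex_gs_center[OF assms(2)] by simp
    then show ?thesis using ends False by simp
  qed
qed

theorem lemma5:
  fixes m k :: nat
    and D :: "(nat \<times> nat) pair_pre_digraph"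
    and r :: "nat \<times> nat"
  assumes "m \<ge> 1" and "k \<ge> 1"
    and "orientation_of D (gs_verts m k) (gs_edges m k)"
    and "sources (with_proj D) = {r} \<or> sinks (with_proj D) = {r}"
    and "end_vertex (gs_edges m k) r \<longleftrightarrow> end_vertex (gs_edges m k) gs_center"
  shows "dominator_chromatic_number (with_proj D) = m * (k - 1) + 2"
proof -
  have "pverts D = gs_verts m k"
    using assms(3) by (simp add: orientation_of_def)
  then have "r \<in> gs_verts m k"
    using assms(4) by (auto simp: sources_def sinks_def)
  then have leaves: "card ({v \<in> gs_verts m k. end_vertex (gs_edges m k) v} - {r}) = m"
    using card_gs_end_vertices_except_root assms(1,2,5) by blast
  have "dominator_chromatic_number (with_proj D) + m = m * k + 2"
    using dominator_chromatic_number_single_source_or_sink[OF assms(3,4) finite_gs_verts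
        Union_gs_edges[OF assms(1,2)] card_gs_edge[OF assms(2)]]
      leaves card_gs_edges[OF assms(2)] card_gs_verts by simp
  moreover have "m * k = m * (k - 1) + m"
    using assms(2) by (cases k) simp_all
  ultimately show ?thesis by simp
qed

end
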